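(* Let $A\in\mathbb{R}^{k\times n}$, let $\Gamma_{\mathrm{prior}}\in\mathbb{R}^{n\times n}$ and $\Gamma_{\mathrm{noise}}\in\mathbb{R}^{k\times k}$ be symmetric positive definite matrices, and let $y=Am+\eta$, where $m\sim\mathcal{N}(0,\Gamma_{\mathrm{prior}})$ and $\eta\sim\mathcal{N}(0,\Gamma_{\mathrm{noise}})$ are independent Gaussian random vectors. Let $\Gamma_{\mathrm{post}}:=(\Gamma_{\mathrm{prior}}^{-1}+A^\top\Gamma_{\mathrm{noise}}^{-1}A)^{-1}$, $m_{\mathrm{LS}}:=A^+y$ and $m_{\mathrm{MAP}}:=\Gamma_{\mathrm{post}}A^\top\Gamma_{\mathrm{noise}}^{-1}y$. Then $$0\le \mathcal{R}(m_{\mathrm{LS}})-\mathcal{R}(m_{\mathrm{MAP}})\le \operatorname{tr}\left[A^+\Gamma_{\mathrm{noise}}(A^+)^\top\right]+\sum_{i=1}^{\mathrm{Nullity}(A)}\lambda_i(\Gamma_{\mathrm{prior}}-\Gamma_{\mathrm{post}}),$$ where $\mathcal{R}$ denotes the Bayes risk.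
   Context: $A^+$ denotes the Moore–Penrose pseudoinverse of $A$. $\mathrm{Nullity}(A)=n-\mathrm{Rank}(A)$ is the dimension of the null space of $A$. For a symmetric matrix $M\in\mathbb{R}^{n\times n}$, $\lambda_1(M)\ge\lambda_2(M)\ge\dots\ge\lambda_n(M)$ are its eigenvalues (with multiplicity) in decreasing order. For an estimator $\hat m$ (a function $y\mapsto\hat m(y)\in\mathbb{R}^n$ of the observations), its Bayes risk is $\mathcal{R}(\hat m):=\mathbb{E}_{m,y}\left[\|\hat m(y)-m\|_2^2\right]$, the expectation being over the joint distribution of $(m,y)$. *)

theory Defs
  imports "HOL-Probability.Probability" "HOL-Computational_Algebra.Computational_Algebra"
begin

definition spd_matrix :: "real^'n^'n \<Rightarrow> bool" where
  "spd_matrix G \<longleftrightarrow> transpose G = G \<and> (\<forall>x. x \<noteq> 0 \<longrightarrow> x \<bullet> (G *v x) > 0)"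

(* The four Penrose conditions; they determine the pseudoinverse uniquely. *)
definition is_pseudoinverse :: "real^'n^'k \<Rightarrow> real^'k^'n \<Rightarrow> bool" where
  "is_pseudoinverse A X \<longleftrightarrow>
     A ** X ** A = A \<and> X ** A ** X = X \<and>
     transpose (A ** X) = A ** X \<and> transpose (X ** A) = X ** A"

definition pseudoinverse :: "real^'n^'k \<Rightarrow> real^'k^'n" where
  "pseudoinverse A = (THE X. is_pseudoinverse A X)"

definition nullity :: "real^'n^'k \<Rightarrow> nat" where
  "nullity (A :: real^'n^'k) = CARD('n) - rank A"

definition charpoly :: "real^'n^'n \<Rightarrow> real poly" where
  "charpoly M = det (\<chi> i j. (if i = j then [:0, 1:] else 0) - [:M $ i $ j:])"

(* Real eigenvalues, listed with algebraic multiplicity in decreasing order. For symmetric M all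
   roots of the characteristic polynomial are real, so the list has length CARD('n). *)
definition eigenvalue_list :: "real^'n^'n \<Rightarrow> real list" where
  "eigenvalue_list M = rev (sorted_list_of_multiset (proots (charpoly M)))"

(* The index i is 1-based: nth_eigenvalue M 1 is the largest eigenvalue. *)
definition nth_eigenvalue :: "real^'n^'n \<Rightarrow> nat \<Rightarrow> real" where
  "nth_eigenvalue M i = eigenvalue_list M ! (i - 1)"

(* Lebesgue density of N(mu, G), for G symmetric positive definite. *)
definition gaussian_density :: "real^'n \<Rightarrow> real^'n^'n \<Rightarrow> real^'n \<Rightarrow> real" where
  "gaussian_density \<mu> (G :: real^'n^'n) x =
     exp (- ((x - \<mu>) \<bullet> (matrix_inv G *v (x - \<mu>))) / 2) / sqrt ((2 * pi) ^ CARD('n) * det G)"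

definition gaussian_vector ::
  "'w measure \<Rightarrow> ('w \<Rightarrow> real^'n) \<Rightarrow> real^'n \<Rightarrow> real^'n^'n \<Rightarrow> bool" where
  "gaussian_vector M X \<mu> G \<longleftrightarrow>
     distributed M lborel X (\<lambda>x. ennreal (gaussian_density \<mu> G x))"

(* prob_space.indep_var requires both variables to take values in the same type, whereas m and the
   noise have different dimensions; this is its unfolding for Borel variables, two types allowed. *)
definition indep_vectors ::
  "'w measure \<Rightarrow> ('w \<Rightarrow> real^'n) \<Rightarrow> ('w \<Rightarrow> real^'k) \<Rightarrow> bool" where
  "indep_vectors M X Y \<longleftrightarrow>
     X \<in> borel_measurable M \<and> Y \<in> borel_measurable M \<and>
     prob_space.indep_set M {X -` B \<inter> space M | B. B \<in> sets borel}
                            {Y -` B \<inter> space M | B. B \<in> sets borel}"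

definition posterior_cov :: "real^'n^'k \<Rightarrow> real^'n^'n \<Rightarrow> real^'k^'k \<Rightarrow> real^'n^'n" where
  "posterior_cov A Gprior Gnoise =
     matrix_inv (matrix_inv Gprior + transpose A ** matrix_inv Gnoise ** A)"

definition LS_estimator :: "real^'n^'k \<Rightarrow> real^'k \<Rightarrow> real^'n" where
  "LS_estimator A z = pseudoinverse A *v z"

definition MAP_estimator ::
  "real^'n^'k \<Rightarrow> real^'n^'n \<Rightarrow> real^'k^'k \<Rightarrow> real^'k \<Rightarrow> real^'n" where
  "MAP_estimator A Gprior Gnoise z =
     (posterior_cov A Gprior Gnoise ** transpose A ** matrix_inv Gnoise) *v z"

(* m and y live on the common probability space M, so the integral over M is the expectation over
   the joint distribution of (m, y). *)
definition bayes_risk ::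
  "'w measure \<Rightarrow> ('w \<Rightarrow> real^'n) \<Rightarrow> ('w \<Rightarrow> real^'k) \<Rightarrow> (real^'k \<Rightarrow> real^'n) \<Rightarrow> real" where
  "bayes_risk M m y est = (\<integral>\<omega>. (norm (est (y \<omega>) - m \<omega>))\<^sup>2 \<partial>M)"

end

theory Submission
  imports Defs "HOL-Real_Asymp.Real_Asymp"
begin

text \<open>
  Both estimators are linear in the data. For a matrix \<open>L\<close> the error of the estimator \<open>L y\<close> is
  \<open>(L A - I) m + L \<eta>\<close>, and since \<open>m\<close> and \<open>\<eta>\<close> are independent and centred, its mean square is
  \<open>tr ((L A - I) Gprior (L A - I)\<^sup>T) + tr (L Gnoise L\<^sup>T)\<close> (\<open>bayes_risk_linear_estimator\<close>). The other
  probabilistic input is the covariance of a Gaussian vector, obtained from its moment generating function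
  (\<open>gaussian_vector_moments\<close>). The rest is matrix algebra.

  The risk is a convex quadratic function of \<open>L\<close>, and the MAP matrix is a stationary point
  (\<open>MAP_normal_equation\<close>), hence a minimizer among linear estimators. This gives the lower bound, and the
  minimal value is the trace of the posterior covariance \<open>\<Gamma>\<close> (\<open>linear_risk_MAP\<close>).

  For the least squares matrix, \<open>N = I - A\<^sup>+ A\<close> is the orthogonal projector onto the kernel of \<open>A\<close>, with
  trace the nullity of \<open>A\<close> (\<open>pseudoinverse_kernel_projector\<close>). Apart from the noise term, the risk difference is
  \<open>tr (N Gprior) - tr \<Gamma>\<close>. This is at most \<open>tr (N (Gprior - \<Gamma>))\<close>, because compressing the positive matrix
  \<open>\<Gamma>\<close> by a projector cannot increase its trace. By Ky Fan's inequality (\<open>ky_fan_projection\<close>), the trace of a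
  symmetric matrix against a projector of rank \<open>r\<close> is at most the sum of its \<open>r\<close> largest eigenvalues.
  Ky Fan's inequality is derived from the spectral theorem, after the roots of the characteristic polynomial have been
  identified with the eigenvalues belonging to an orthonormal eigenbasis.
\<close>

section \<open>Matrix algebra and positive definite matrices\<close>

lemma matrix_add_rdistrib: "((A :: real^'n^'m) + B) ** (C :: real^'p^'n) = A ** C + B ** C"
  by (simp add: matrix_matrix_mult_def vec_eq_iff distrib_right sum.distrib)

lemma matrix_diff_ldistrib: "(A :: real^'n^'m) ** ((B :: real^'p^'n) - C) = A ** B - A ** C"
  by (simp add: matrix_matrix_mult_def vec_eq_iff right_diff_distrib sum_subtractf)

lemma matrix_diff_rdistrib: "((A :: real^'n^'m) - B) ** (C :: real^'p^'n) = A ** C - B ** C"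
  by (simp add: matrix_matrix_mult_def vec_eq_iff left_diff_distrib sum_subtractf)

lemma transpose_add: "transpose ((A :: real^'n^'m) + B) = transpose A + transpose B"
  by (simp add: transpose_def vec_eq_iff)

lemma transpose_diff: "transpose ((A :: real^'n^'m) - B) = transpose A - transpose B"
  by (simp add: transpose_def vec_eq_iff)

lemma inner_matrix_vector_transpose:
  "(x :: real^'m) \<bullet> ((A :: real^'n^'m) *v y) = (transpose A *v x) \<bullet> y"
  by (simp add: dot_lmul_matrix)

lemma matrix_inv_eqI:
  fixes A B :: "real^'n^'n"
  assumes "A ** B = mat 1"
  shows "matrix_inv A = B"
proof -
  have BA: "B ** A = mat 1" using assms matrix_left_right_inverse by blast
  have "A ** matrix_inv A = mat 1 \<and> matrix_inv A ** A = mat 1"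
    unfolding matrix_inv_def by (rule someI[of _ B]) (use assms BA in simp)
  then show ?thesis
    by (metis BA matrix_mul_assoc matrix_mul_lid matrix_mul_rid)
qed

lemma spd_matrix_inverse:
  fixes G :: "real^'n^'n"
  assumes "spd_matrix G"
  shows "G ** matrix_inv G = mat 1" "matrix_inv G ** G = mat 1"
    "transpose (matrix_inv G) = matrix_inv G" "spd_matrix (matrix_inv G)"
proof -
  have sym: "transpose G = G" and pos: "\<And>x. x \<noteq> 0 \<Longrightarrow> x \<bullet> (G *v x) > 0"
    using assms by (auto simp: spd_matrix_def)
  have "x = 0" if "G *v x = 0" for x
    using pos[of x] that by force
  then obtain B where B: "B ** G = mat 1"
    using matrix_left_invertible_ker[of G] by blast
  then have GB: "G ** B = mat 1" using matrix_left_right_inverse by blast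
  have inv: "matrix_inv G = B" by (rule matrix_inv_eqI[OF GB])
  have "transpose B ** G = mat 1"
    by (metis GB matrix_transpose_mul sym transpose_mat)
  then have symB: "transpose B = B"
    by (metis GB matrix_mul_assoc matrix_mul_lid matrix_mul_rid)
  show "G ** matrix_inv G = mat 1" "matrix_inv G ** G = mat 1" "transpose (matrix_inv G) = matrix_inv G"
    using B GB inv symB by auto
  have "x \<bullet> (B *v x) > 0" if "x \<noteq> 0" for x
  proof -
    have x: "G *v (B *v x) = x" by (simp add: matrix_vector_mul_assoc GB)
    have "B *v x \<noteq> 0" using x that by (metis matrix_vector_mult_0_right)
    from pos[OF this] show ?thesis by (simp add: x inner_commute)
  qed
  then show "spd_matrix (matrix_inv G)"
    by (simp add: spd_matrix_def inv symB)
qed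

section \<open>The spectral theorem for symmetric matrices\<close>

text \<open>
  This is the variational step behind the spectral theorem: a quadratic polynomial in \<open>t\<close> that vanishes
  at \<open>t = 0\<close> and is nonnegative everywhere has no linear term.
\<close>

lemma linear_coefficient_zero_if_nonneg:
  fixes b c :: real
  assumes "\<And>t. 0 \<le> 2 * t * b + t\<^sup>2 * c"
  shows "b = 0"
proof (rule ccontr)
  assume b: "b \<noteq> 0"
  \<comment> \<open>For this \<open>k\<close> the polynomial is negative at \<open>t = - b / k\<close>.\<close>
  define k where "k = \<bar>c\<bar> + 1"
  have k: "k > 0" "c < 2 * k" by (auto simp: k_def)
  have "2 * (- b / k) * b + (- b / k)\<^sup>2 * c = (b\<^sup>2 / k\<^sup>2) * (c - 2 * k)"
    using k by (simp add: field_simps power2_eq_square)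
  also have "\<dots> < 0" using b k by (intro mult_pos_neg) auto
  finally show False using assms[of "- b / k"] by linarith
qed

text \<open>
  The quadratic form \<open>x \<bullet> S x\<close> attains its maximum on the compact unit sphere of \<open>W\<close>, and a maximizer is an
  eigenvector. Working in an invariant subspace makes it possible to look for a further eigenvector in the
  orthogonal complement of those already found.
\<close>

lemma symmetric_matrix_eigenvector:
  fixes S :: "real^'n^'n"
  assumes sym: "transpose S = S" and W: "subspace W" "W \<noteq> {0}"
    and inv: "\<And>w. w \<in> W \<Longrightarrow> S *v w \<in> W"
  obtains v \<mu> where "v \<in> W" "norm v = 1" "S *v v = \<mu> *\<^sub>R v"
proof -
  have symI: "x \<bullet> (S *v y) = (S *v x) \<bullet> y" for x y
    using inner_matrix_vector_transpose[of x S y] by (simp only: sym)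
  let ?K = "W \<inter> sphere 0 1"
  obtain w where w: "w \<in> W" "w \<noteq> 0" using W subspace_0 by blast
  have "compact ?K" by (simp add: closed_subspace[OF W(1)] closed_Int_compact)
  moreover have "(1 / norm w) *\<^sub>R w \<in> ?K" using w W by (simp add: subspace_scale)
  moreover have "continuous_on ?K (\<lambda>x. x \<bullet> (S *v x))"
    by (intro continuous_intros linear_continuous_on matrix_vector_mul_bounded_linear)
  ultimately have "\<exists>v\<in>?K. \<forall>x\<in>?K. x \<bullet> (S *v x) \<le> v \<bullet> (S *v v)"
    using continuous_attains_sup[of ?K "\<lambda>x. x \<bullet> (S *v x)"] by blast
  then obtain v where v: "v \<in> ?K" and max: "\<And>x. x \<in> ?K \<Longrightarrow> x \<bullet> (S *v x) \<le> v \<bullet> (S *v v)"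
    by blast
  define \<mu> where "\<mu> = v \<bullet> (S *v v)"
  have q: "x \<bullet> (S *v x) \<le> \<mu> * (x \<bullet> x)" if "x \<in> W" for x
  proof (cases "x = 0")
    case False
    have "(1 / norm x) *\<^sub>R x \<in> ?K" using that False W by (simp add: subspace_scale)
    from max[OF this] have "(x \<bullet> (S *v x)) / (norm x)\<^sup>2 \<le> \<mu>"
      by (simp add: matrix_vector_mult_scaleR \<mu>_def power2_eq_square)
    then show ?thesis using False by (simp add: field_simps power2_norm_eq_inner)
  qed simp
  have vv: "v \<bullet> v = 1" and vW: "v \<in> W" using v by (auto simp: norm_eq_1)
  \<comment> \<open>The form \<open>\<mu> |x|^2 - x \<bullet> S x\<close> is nonnegative on \<open>W\<close> and vanishes at \<open>v\<close>, so \<open>v\<close> lies in its radical.\<close>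
  have rad: "w \<bullet> (\<mu> *\<^sub>R v - S *v v) = 0" if w: "w \<in> W" for w
  proof (rule linear_coefficient_zero_if_nonneg)
    fix t :: real
    have "v + t *\<^sub>R w \<in> W" using W w vW by (simp add: subspace_add subspace_scale)
    from q[OF this]
    have "0 \<le> \<mu> * ((v + t *\<^sub>R w) \<bullet> (v + t *\<^sub>R w)) - (v + t *\<^sub>R w) \<bullet> (S *v (v + t *\<^sub>R w))"
      by simp
    also have "\<dots> = 2 * t * (w \<bullet> (\<mu> *\<^sub>R v - S *v v)) + t\<^sup>2 * (\<mu> * (w \<bullet> w) - w \<bullet> (S *v w))"
      using symI[of v w] vv
      by (simp add: matrix_vector_right_distrib matrix_vector_mult_scaleR inner_add_left inner_add_right
          inner_diff_right \<mu>_def[symmetric] inner_commute algebra_simps power2_eq_square)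
    finally show "0 \<le> 2 * t * (w \<bullet> (\<mu> *\<^sub>R v - S *v v)) + t\<^sup>2 * (\<mu> * (w \<bullet> w) - w \<bullet> (S *v w))" .
  qed
  have "\<mu> *\<^sub>R v - S *v v \<in> W" using W vW inv by (simp add: subspace_diff subspace_scale)
  from rad[OF this] have "S *v v = \<mu> *\<^sub>R v" by simp
  with vW v that show ?thesis by auto
qed

text \<open>
  The spectral theorem. An orthonormal set of eigenvectors of largest possible size spans the whole space:
  its orthogonal complement is invariant under the symmetric matrix, hence would otherwise contain another
  unit eigenvector. The basis is indexed by the index type of the matrix, so that it can be used as the
  columns of a square matrix.
\<close>

lemma symmetric_matrix_orthonormal_eigenbasis:
  fixes S :: "real^'n^'n"
  assumes sym: "transpose S = S"
  obtains v :: "'n \<Rightarrow> real^'n" and d :: "'n \<Rightarrow> real"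
  where "\<And>i j. v i \<bullet> v j = (if i = j then 1 else 0)" "\<And>i. S *v v i = d i *\<^sub>R v i"
proof -
  have symI: "x \<bullet> (S *v y) = (S *v x) \<bullet> y" for x y
    using inner_matrix_vector_transpose[of x S y] by (simp only: sym)
  define P where "P B \<longleftrightarrow> pairwise orthogonal B \<and> (\<forall>b\<in>B. norm b = 1 \<and> (\<exists>\<mu>. S *v b = \<mu> *\<^sub>R b))"
    for B :: "(real^'n) set"
  have ind: "independent B" if "P B" for B
  proof (rule pairwise_orthogonal_independent)
    show "pairwise orthogonal B" using that by (simp add: P_def)
    show "0 \<notin> B" using that by (auto simp: P_def)
  qed
  have bound: "finite B \<and> card B \<le> CARD('n)" if "P B" for B
    using independent_bound_general[OF ind[OF that]] independent_imp_finite[OF ind[OF that]]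
      dim_subset_UNIV[of B] by auto
  have "P {}" by (simp add: P_def)
  then have "\<exists>B. P B \<and> (\<forall>C. P C \<longrightarrow> card C \<le> card B)"
    using ex_has_greatest_nat[of P "{}" card "Suc CARD('n)"] bound by (auto simp: less_Suc_eq_le)
  then obtain B where B: "P B" and Bmax: "\<And>C. P C \<Longrightarrow> card C \<le> card B" by blast
  have finB: "finite B" using bound B by blast
  define W where "W = {w. \<forall>b\<in>B. b \<bullet> w = 0}"
  have W: "subspace W" by (auto simp: W_def subspace_def inner_add_right)
  have "W = {0}"
  proof (rule ccontr)
    assume "W \<noteq> {0}"
    moreover have "S *v w \<in> W" if "w \<in> W" for w
      unfolding W_def
    proof safe
      fix b assume b: "b \<in> B"
      then obtain \<mu> where "S *v b = \<mu> *\<^sub>R b" using B by (auto simp: P_def)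
      then show "b \<bullet> (S *v w) = 0" using that b by (simp add: symI W_def)
    qed
    ultimately obtain v \<mu> where v: "v \<in> W" "norm v = 1" "S *v v = \<mu> *\<^sub>R v"
      using symmetric_matrix_eigenvector[OF sym W] by blast
    have "v \<notin> B" using v by (auto simp: W_def dest!: bspec[of _ _ v])
    have "P (insert v B)"
      using v B by (auto simp: P_def W_def pairwise_insert orthogonal_def inner_commute)
    from Bmax[OF this] \<open>v \<notin> B\<close> finB show False by simp
  qed
  have "dim {y \<in> UNIV. \<forall>x \<in> span B. orthogonal x y} + dim (span B) = dim (UNIV :: (real^'n) set)"
    by (rule dim_subspace_orthogonal_to_vectors) auto
  moreover have "{y \<in> UNIV. \<forall>x \<in> span B. orthogonal x y} \<subseteq> W"
    by (auto simp: W_def orthogonal_def span_base)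
  then have "{y \<in> UNIV. \<forall>x \<in> span B. orthogonal x y} \<subseteq> {0}" using \<open>W = {0}\<close> by simp
  then have "dim {y \<in> UNIV. \<forall>x \<in> span B. orthogonal x y} = 0"
    by (simp only: dim_eq_0)
  ultimately have "card B = CARD('n)"
    using dim_span_eq_card_independent[OF ind[OF B]] by (simp only: dim_UNIV DIM_cart DIM_real)
  then obtain v :: "'n \<Rightarrow> real^'n" where v: "bij_betw v UNIV B"
    using finite_same_card_bij[OF finite finB, of "UNIV :: 'n set"] by auto
  have vB: "v i \<in> B" for i using v by (auto simp: bij_betw_def)
  then have "\<exists>\<mu>. S *v v i = \<mu> *\<^sub>R v i" for i using B by (auto simp: P_def)
  then obtain d where d: "\<And>i. S *v v i = d i *\<^sub>R v i" by metis
  have "v i \<bullet> v j = (if i = j then 1 else 0)" for i j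
  proof (cases "i = j")
    case False
    then have "v i \<noteq> v j" using v by (auto simp: bij_betw_def inj_def)
    then show ?thesis using False vB[of i] vB[of j] B by (auto simp: P_def pairwise_def orthogonal_def)
  qed (use vB[of i] B in \<open>auto simp: P_def norm_eq_1\<close>)
  with d that show ?thesis by blast
qed

section \<open>Eigenvalue lists and Ky Fan's inequality\<close>

text \<open>
  With the eigenvectors as the columns of \<open>V\<close>, one has \<open>(x I - S) V = V (x I - D)\<close> over the
  ring of polynomials, where \<open>D\<close> is diagonal. The determinant is multiplicative over any commutative ring,
  and \<open>det V\<close> is a unit because \<open>V\<close> is orthogonal, so it cancels.
\<close>

lemma charpoly_eigenbasis:
  fixes S :: "real^'n^'n" and v :: "'n \<Rightarrow> real^'n" and d :: "'n \<Rightarrow> real"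
  assumes on: "\<And>i j. v i \<bullet> v j = (if i = j then 1 else 0)" and eig: "\<And>i. S *v v i = d i *\<^sub>R v i"
  shows "charpoly S = (\<Prod>i\<in>UNIV. [:- d i, 1:])"
proof -
  define V :: "real poly^'n^'n" where "V = (\<chi> i j. [:v j $ i:])"
  define V' :: "real poly^'n^'n" where "V' = (\<chi> i j. [:v i $ j:])"
  define X :: "real poly^'n^'n" where "X = (\<chi> i j. (if i = j then [:0, 1:] else 0) - [:S $ i $ j:])"
  define D :: "real poly^'n^'n" where "D = (\<chi> i j. if i = j then [:- d i, 1:] else 0)"
  have const: "(\<Sum>k\<in>A. [:f k:] * [:g k:]) = [:\<Sum>k\<in>A. f k * g k:]" for f g :: "'n \<Rightarrow> real" and A
    by (induction A rule: infinite_finite_induct) (auto simp: mult.commute)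
  have V'V: "V' ** V = mat 1"
    using on by (auto simp: V_def V'_def matrix_matrix_mult_def vec_eq_iff mat_def const[simplified] inner_vec_def one_pCons)
  have "X ** V = V ** D"
  proof -
    have "(\<Sum>k\<in>UNIV. S $ i $ k * v j $ k) = d j * v j $ i" for i j
      using arg_cong[OF eig[of j], of "\<lambda>x. x $ i"] by (simp add: matrix_vector_mult_def)
    note eig_coord = this
    have "(X ** V) $ i $ j = (V ** D) $ i $ j" for i j
    proof -
      have "(X ** V) $ i $ j
          = (\<Sum>k\<in>UNIV. (if i = k then [:0, 1:] else 0) * [:v j $ k:] - [:S $ i $ k:] * [:v j $ k:])"
        unfolding X_def V_def matrix_matrix_mult_def by (simp only: vec_lambda_beta left_diff_distrib)
      also have "\<dots> = (\<Sum>k\<in>UNIV. if i = k then [:0, 1:] * [:v j $ k:] else 0) - [:d j * v j $ i:]"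
        unfolding sum_subtractf const eig_coord by (intro arg_cong2[of _ _ _ _ "(-)"] sum.cong) auto
      also have "\<dots> = [:v j $ i:] * [:- d j, 1:]" by simp
      also have "\<dots> = (V ** D) $ i $ j"
        by (simp add: V_def D_def matrix_matrix_mult_def if_distrib[of "\<lambda>x. _ * x"] cong: if_cong)
      finally show ?thesis .
    qed
    then show ?thesis by (simp add: vec_eq_iff)
  qed
  then have "det V' * (det X * det V) = det V' * (det V * det D)"
    by (metis det_mul)
  moreover have "det V' * det V = 1" by (metis V'V det_mul det_I)
  ultimately have "det X = det D" by (metis (no_types, lifting) mult.commute mult.left_commute mult.right_neutral)
  also have "det D = (\<Prod>i\<in>UNIV. [:- d i, 1:])"
    by (subst det_diagonal) (auto simp: D_def)
  finally show ?thesis by (simp add: charpoly_def X_def)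
qed

lemma eigenvalue_list_eigenbasis:
  fixes S :: "real^'n^'n" and v :: "'n \<Rightarrow> real^'n" and d :: "'n \<Rightarrow> real"
  assumes on: "\<And>i j. v i \<bullet> v j = (if i = j then 1 else 0)" and eig: "\<And>i. S *v v i = d i *\<^sub>R v i"
  shows "mset (eigenvalue_list S) = image_mset d (mset_set UNIV)"
    "sorted_wrt (\<ge>) (eigenvalue_list S)"
proof -
  have "proots (charpoly S) = (\<Sum>i\<in>UNIV. {#d i#})"
    unfolding charpoly_eigenbasis[OF assms] by (subst proots_prod) auto
  also have "\<dots> = image_mset d (mset_set UNIV)"
    by (rule sum_unfold_sum_mset[THEN trans]) simp
  finally show "mset (eigenvalue_list S) = image_mset d (mset_set UNIV)"
    by (simp add: eigenvalue_list_def)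
  show "sorted_wrt (\<ge>) (eigenvalue_list S)"
    by (simp add: eigenvalue_list_def sorted_wrt_rev)
qed

text \<open>
  A fractional choice of \<open>r\<close> entries does not beat the \<open>r\<close> largest ones. Subtracting the threshold
  \<open>t\<close>, the \<open>r\<close>-th largest entry, from all entries changes both sides by \<open>t r\<close>. After that the
  weights can only lower the sum of the positive parts, and the positive parts are carried by the first
  \<open>r\<close> entries. Sums over positive parts depend on the multiset of entries only, which is how the list and the
  indexed family are compared.
\<close>

lemma weighted_sum_le_largest:
  fixes d w :: "'n::finite \<Rightarrow> real" and l :: "real list"
  assumes l: "mset l = image_mset d (mset_set UNIV)" "sorted_wrt (\<ge>) l"
    and w: "\<And>i. 0 \<le> w i" "\<And>i. w i \<le> 1" and sum: "(\<Sum>i\<in>UNIV. w i) = real r"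
    and r: "r \<le> CARD('n)"
  shows "(\<Sum>i\<in>UNIV. d i * w i) \<le> (\<Sum>i<r. l ! i)"
proof (cases "r = 0")
  case True
  then have "w i = 0" for i
    using sum w by (simp add: sum_nonneg_eq_0_iff)
  with True show ?thesis by simp
next
  case False
  have len: "length l = CARD('n)"
    using arg_cong[OF l(1), of size] by simp
  define t where "t = l ! (r - 1)"
  have "(\<Sum>i\<in>UNIV. d i * w i) - t * r = (\<Sum>i\<in>UNIV. (d i - t) * w i)"
    by (simp add: sum[symmetric] sum_distrib_left left_diff_distrib sum_subtractf)
  also have "\<dots> \<le> (\<Sum>i\<in>UNIV. max 0 (d i - t))"
  proof (rule sum_mono)
    fix i
    show "(d i - t) * w i \<le> max 0 (d i - t)"
    proof (cases "d i \<ge> t")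
      case True
      then show ?thesis using w(2)[of i] mult_left_le[of "w i" "d i - t"] by auto
    next
      case False
      then show ?thesis using w(1)[of i] by (simp add: mult_nonpos_nonneg)
    qed
  qed
  also have "\<dots> = sum_mset (image_mset (\<lambda>x. max 0 (x - t)) (mset l))"
    unfolding l(1) by (simp add: image_mset.compositionality comp_def sum_unfold_sum_mset)
  also have "\<dots> = (\<Sum>i<CARD('n). max 0 (l ! i - t))"
    by (simp add: sum_mset_sum_list sum_list_sum_nth len atLeast0LessThan flip: mset_map)
  also have "\<dots> = (\<Sum>i<r. l ! i - t)"
  proof (rule sum.mono_neutral_cong_right)
    show "\<forall>i\<in>{..<CARD('n)} - {..<r}. max 0 (l ! i - t) = 0"
    proof
      fix i assume "i \<in> {..<CARD('n)} - {..<r}"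
      then have "l ! (r - 1) \<ge> l ! i"
        using l(2) len False by (auto simp: sorted_wrt_iff_nth_less)
      then show "max 0 (l ! i - t) = 0" by (simp add: t_def)
    qed
    show "max 0 (l ! i - t) = l ! i - t" if "i \<in> {..<r}" for i
    proof -
      have "l ! i \<ge> l ! (r - 1)"
        using l(2) len False that r by (cases "i = r - 1") (auto simp: sorted_wrt_iff_nth_less)
      then show ?thesis by (simp add: t_def)
    qed
  qed (use r in auto)
  also have "\<dots> = (\<Sum>i<r. l ! i) - t * r" by (simp add: sum_subtractf)
  finally show ?thesis by simp
qed

text \<open>
  The trace is invariant under an orthogonal change of basis.
\<close>

lemma sum_inner_orthonormal_basis:
  fixes v :: "'n \<Rightarrow> real^'n" and N :: "real^'n^'n"
  assumes on: "\<And>i j. v i \<bullet> v j = (if i = j then 1 else 0)"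
  shows "(\<Sum>i\<in>UNIV. v i \<bullet> (N *v v i)) = trace N"
proof -
  define V :: "real^'n^'n" where "V = (\<chi> i j. v j $ i)"
  have VV: "transpose V ** V = mat 1"
    using on by (auto simp: V_def transpose_def matrix_matrix_mult_def vec_eq_iff mat_def inner_vec_def)
  then have VV': "V ** transpose V = mat 1" using matrix_left_right_inverse by blast
  have "(\<Sum>i\<in>UNIV. v i \<bullet> (N *v v i)) = trace (transpose V ** (N ** V))"
    by (simp add: trace_def transpose_def V_def matrix_matrix_mult_def matrix_vector_mult_def inner_vec_def)
  also have "\<dots> = trace (N ** V ** transpose V)" by (rule trace_mul_sym)
  also have "\<dots> = trace N" by (simp add: VV' flip: matrix_mul_assoc)
  finally show ?thesis .
qed

text \<open>
  One half of Ky Fan's maximum principle. In an eigenbasis of \<open>S\<close> the trace of \<open>N S\<close> is the sum of the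
  eigenvalues with weights \<open>v i \<bullet> N (v i)\<close>. For an orthogonal projector \<open>N\<close> these weights lie
  between 0 and 1, and they add up to the trace of \<open>N\<close>, which is its rank.
\<close>

lemma ky_fan_projection:
  fixes S N :: "real^'n^'n"
  assumes S: "transpose S = S" and N: "transpose N = N" "N ** N = N" and tr: "trace N = real r"
  shows "trace (N ** S) \<le> (\<Sum>i = 1..r. nth_eigenvalue S i)"
proof -
  obtain v :: "'n \<Rightarrow> real^'n" and d where on: "\<And>i j. v i \<bullet> v j = (if i = j then 1 else 0)"
    and eig: "\<And>i. S *v v i = d i *\<^sub>R v i"
    using symmetric_matrix_orthonormal_eigenbasis[OF S] by metis
  define w where "w i = v i \<bullet> (N *v v i)" for i
  have w_norm: "w i = (N *v v i) \<bullet> (N *v v i)" for i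
    using inner_matrix_vector_transpose[of "v i" N "N *v v i"]
    by (simp only: w_def matrix_vector_mul_assoc N)
  have w0: "0 \<le> w i" for i by (simp add: w_norm)
  have w1: "w i \<le> 1" for i
  proof -
    have "0 \<le> (v i - N *v v i) \<bullet> (v i - N *v v i)" by simp
    also have "\<dots> = 1 - w i"
      using w_norm[of i] on[of i i]
      by (simp add: inner_diff_left inner_diff_right w_def inner_commute)
    finally show ?thesis by simp
  qed
  have sum: "(\<Sum>i\<in>UNIV. w i) = real r"
    unfolding w_def sum_inner_orthonormal_basis[OF on] tr ..
  have "real r \<le> (\<Sum>i\<in>(UNIV::'n set). 1)"
    unfolding sum[symmetric] by (rule sum_mono) (rule w1)
  then have r: "r \<le> CARD('n)" by simp
  have "trace (N ** S) = (\<Sum>i\<in>UNIV. d i * w i)"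
    unfolding sum_inner_orthonormal_basis[OF on, symmetric]
    by (simp add: eig w_def matrix_vector_mult_scaleR flip: matrix_vector_mul_assoc)
  also have "\<dots> \<le> (\<Sum>i<r. eigenvalue_list S ! i)"
    by (rule weighted_sum_le_largest[OF eigenvalue_list_eigenbasis[OF on eig] w0 w1 sum r])
  also have "\<dots> = (\<Sum>i = 1..r. nth_eigenvalue S i)"
    by (simp add: nth_eigenvalue_def sum.atLeast1_atMost_eq)
  finally show ?thesis .
qed

section \<open>The pseudoinverse and the projector onto the kernel\<close>

text \<open>
  Penrose's uniqueness argument: the Penrose conditions make \<open>A X\<close> the orthogonal projector onto the
  range of \<open>A\<close> and \<open>X A\<close> the one onto its row space. Two solutions thus share both products, and
  \<open>X = X A X\<close> is recovered from them.
\<close>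

lemma pseudoinverse_eqI:
  fixes A :: "real^'n^'k"
  assumes X: "is_pseudoinverse A X"
  shows "pseudoinverse A = X"
  unfolding pseudoinverse_def
proof (rule the_equality)
  show "is_pseudoinverse A X" by (rule X)
next
  fix Y assume Y: "is_pseudoinverse A Y"
  have x: "A ** X ** A = A" "X ** A ** X = X" "transpose (A ** X) = A ** X" "transpose (X ** A) = X ** A"
    and y: "A ** Y ** A = A" "Y ** A ** Y = Y" "transpose (A ** Y) = A ** Y" "transpose (Y ** A) = Y ** A"
    using X Y by (auto simp: is_pseudoinverse_def)
  have "A ** X = A ** Y"
  proof -
    have "A ** X = transpose (A ** Y ** A ** X)" using x y by (simp add: matrix_mul_assoc)
    also have "\<dots> = A ** X ** (A ** Y)" 
      using x(3) y(3) by (metis matrix_mul_assoc matrix_transpose_mul)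
    also have "\<dots> = A ** Y" using x(1) by (simp add: matrix_mul_assoc)
    finally show ?thesis .
  qed
  moreover have "X ** A = Y ** A"
  proof -
    have "X ** A = transpose (X ** (A ** Y ** A))" using x y by simp
    also have "\<dots> = Y ** A ** (X ** A)"
      using x(4) y(4) by (metis matrix_mul_assoc matrix_transpose_mul)
    also have "\<dots> = Y ** (A ** X ** A)" by (simp add: matrix_mul_assoc)
    also have "\<dots> = Y ** A" using x(1) by simp
    finally show ?thesis .
  qed
  ultimately show "Y = X" using x(2) y(2) by (metis matrix_mul_assoc)
qed

text \<open>
  The projector is the sum of the matrices \<open>b b\<^sup>T\<close> over an orthonormal basis of the kernel. Each summand
  has trace 1, so the trace counts the dimension of the kernel, which rank-nullity identifies.
\<close>

lemma orthogonal_projector_kernel: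
  fixes A :: "real^'n^'k"
  obtains N :: "real^'n^'n"
  where "transpose N = N" "N ** N = N" "A ** N = 0" "\<And>x. A *v x = 0 \<Longrightarrow> N *v x = x"
    "trace N = real (nullity A)"
proof -
  define K where "K = {x. A *v x = 0}"
  have K: "subspace K"
    by (auto simp: K_def subspace_def matrix_vector_right_distrib matrix_vector_mult_scaleR)
  obtain B where B: "B \<subseteq> K" "pairwise orthogonal B" "\<And>x. x \<in> B \<Longrightarrow> norm x = 1"
    "independent B" "card B = dim K" "span B = K"
    using orthonormal_basis_subspace[OF K] by metis
  have finB: "finite B" using B(4) independent_imp_finite by blast
  have on: "b \<bullet> c = (if b = c then 1 else 0)" if "b \<in> B" "c \<in> B" for b c
    using that B(2,3) by (auto simp: pairwise_def orthogonal_def norm_eq_1)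
  define N :: "real^'n^'n" where "N = (\<chi> i j. \<Sum>b\<in>B. b $ i * b $ j)"
  have Nv: "N *v x = (\<Sum>b\<in>B. (b \<bullet> x) *\<^sub>R b)" for x
  proof -
    have "(N *v x) $ i = (\<Sum>b\<in>B. (b \<bullet> x) *\<^sub>R b) $ i" for i
      unfolding N_def matrix_vector_mult_def inner_vec_def
      by (simp add: sum_distrib_right sum_distrib_left mult_ac)
         (rule sum.swap)
    then show ?thesis by (simp add: vec_eq_iff)
  qed
  have NB: "N *v b = b" if "b \<in> B" for b
    unfolding Nv using that finB on by (simp add: if_distrib[of "\<lambda>x. x *\<^sub>R _"] sum.delta' cong: sum.cong if_cong)
  have NK: "N *v x = x" if "x \<in> K" for x
  proof -
    have "x \<in> span B" using that B by simp
    then show ?thesis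
      by (induction rule: span_induct_alt)
        (auto simp: matrix_vector_right_distrib matrix_vector_mult_scaleR NB)
  qed
  have NinK: "N *v x \<in> K" for x
    unfolding Nv using K B(1) by (intro subspace_sum subspace_scale) auto
  have "transpose N = N" by (simp add: N_def transpose_def vec_eq_iff mult.commute)
  moreover have "N ** N = N"
    by (simp add: matrix_eq NK NinK flip: matrix_vector_mul_assoc)
  moreover have "A ** N = 0"
    using NinK by (simp add: matrix_eq K_def flip: matrix_vector_mul_assoc)
  moreover have "N *v x = x" if "A *v x = 0" for x using NK that by (simp add: K_def)
  moreover have "trace N = real (nullity A)"
  proof -
    have "trace N = (\<Sum>b\<in>B. b \<bullet> b)"
      unfolding trace_def N_def inner_vec_def by (simp add: sum.swap[of _ UNIV B])
    also have "\<dots> = real (dim K)" using on by (simp add: B(5) cong: sum.cong)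
    also have "dim K = nullity A"
    proof -
      have "K = {y \<in> UNIV. \<forall>x \<in> span (rows A). orthogonal x y}"
      proof (intro set_eqI iffI)
        fix y assume "y \<in> K"
        then show "y \<in> {y \<in> UNIV. \<forall>x \<in> span (rows A). orthogonal x y}"
          using orthogonal_nullspace_rowspace[of A y] by (auto simp: K_def orthogonal_commute)
      next
        fix y assume "y \<in> {y \<in> UNIV. \<forall>x \<in> span (rows A). orthogonal x y}"
        then have "row i A \<bullet> y = 0" for i
          by (auto simp: rows_def orthogonal_def intro!: span_base)
        then show "y \<in> K"
          by (simp add: K_def vec_eq_iff matrix_vector_mul_component row_def vec_nth_inverse)
      qed
      moreover have "dim {y \<in> UNIV. \<forall>x \<in> span (rows A). orthogonal x y} + dim (span (rows A))
          = dim (UNIV :: (real^'n) set)"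
        by (rule dim_subspace_orthogonal_to_vectors) auto
      ultimately have "dim K + rank A = CARD('n)" by (simp add: row_rank_def)
      then show ?thesis by (simp add: nullity_def)
    qed
    finally show ?thesis .
  qed
  ultimately show ?thesis using that by blast
qed

text \<open>
  This also shows that the pseudoinverse exists, by an explicit formula. If \<open>P\<close> is the orthogonal
  projector onto the kernel of \<open>A\<close>, then \<open>B = A\<^sup>T A + P\<close> is positive definite, because \<open>P\<close> takes
  care of exactly those vectors that \<open>A\<close> annihilates. As \<open>B P = P\<close>, the matrix \<open>B\<^sup>-\<^sup>1 A\<^sup>T\<close>
  satisfies the Penrose conditions, and its product with \<open>A\<close> is \<open>I - P\<close>.
\<close>

lemma pseudoinverse_kernel_projector:
  fixes A :: "real^'n^'k"
  defines "N \<equiv> mat 1 - pseudoinverse A ** A"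
  shows "transpose N = N" "N ** N = N" "trace N = real (nullity A)"
proof -
  obtain P :: "real^'n^'n" where P: "transpose P = P" "P ** P = P" "A ** P = 0"
    "\<And>x. A *v x = 0 \<Longrightarrow> P *v x = x" "trace P = real (nullity A)"
    using orthogonal_projector_kernel by blast
  have PA: "P ** transpose A = 0"
    using arg_cong[OF P(3), of transpose] P(1)
    by (simp add: matrix_transpose_mul) (simp add: transpose_def vec_eq_iff)
  define B where "B = transpose A ** A + P"
  have B: "spd_matrix B"
    unfolding spd_matrix_def
  proof (intro conjI allI impI)
    show "transpose B = B" by (simp add: B_def transpose_add matrix_transpose_mul P)
    fix x :: "real^'n" assume x: "x \<noteq> 0"
    have "x \<bullet> (P *v x) = (P *v x) \<bullet> (P *v x)"
      using inner_matrix_vector_transpose[of x P "P *v x"] by (simp only: matrix_vector_mul_assoc P)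
    moreover have "x \<bullet> (transpose A *v (A *v x)) = (A *v x) \<bullet> (A *v x)"
      using inner_matrix_vector_transpose[of x "transpose A" "A *v x"] by (simp only: transpose_transpose)
    ultimately have eq: "x \<bullet> (B *v x) = (A *v x) \<bullet> (A *v x) + (P *v x) \<bullet> (P *v x)"
      unfolding B_def by (simp only: matrix_vector_mult_add_rdistrib matrix_vector_mul_assoc[symmetric] inner_add_right)
    have "A *v x \<noteq> 0 \<or> P *v x \<noteq> 0" using P(4)[of x] x by auto
    then show "0 < x \<bullet> (B *v x)" unfolding eq
      by (metis add_nonneg_pos add_pos_nonneg inner_ge_zero inner_gt_zero_iff)
  qed
  define C where "C = matrix_inv B"
  have C: "B ** C = mat 1" "C ** B = mat 1" "transpose C = C"
    using spd_matrix_inverse[OF B] by (auto simp: C_def)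
  have "B ** P = P" by (simp add: B_def matrix_add_rdistrib P flip: matrix_mul_assoc)
  then have CP: "C ** P = P" by (metis C(2) matrix_mul_assoc matrix_mul_lid)
  then have PC: "P ** C = P" by (metis C(3) P(1) matrix_transpose_mul)
  define X where "X = C ** transpose A"
  have XA: "X ** A = mat 1 - P"
  proof -
    have "X ** A = C ** (B - P)" by (simp add: X_def B_def flip: matrix_mul_assoc)
    then show ?thesis by (simp add: matrix_diff_ldistrib C CP)
  qed
  have "is_pseudoinverse A X"
    unfolding is_pseudoinverse_def
  proof (intro conjI)
    show "A ** X ** A = A" by (simp add: XA matrix_diff_ldistrib P flip: matrix_mul_assoc)
    show "X ** A ** X = X"
      unfolding XA by (simp add: matrix_diff_rdistrib) (simp add: X_def matrix_mul_assoc PC PA)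
    show "transpose (A ** X) = A ** X"
      by (simp add: X_def matrix_transpose_mul C matrix_mul_assoc)
    show "transpose (X ** A) = X ** A" by (simp add: XA transpose_diff P transpose_mat)
  qed
  then have "N = P" by (simp add: N_def pseudoinverse_eqI XA)
  with P show "transpose N = N" "N ** N = N" "trace N = real (nullity A)" by auto
qed

section \<open>Moments of Gaussian vectors\<close>

lemma abs_sinh_le: "\<bar>sinh (u :: real)\<bar> \<le> \<bar>u\<bar> * exp \<bar>u\<bar>"
proof -
  have *: "sinh u \<le> u * exp u" if "u \<ge> 0" for u :: real
  proof -
    have "(1 - exp (- (2 * u))) * exp u \<le> 2 * u * exp u"
      using exp_ge_add_one_self[of "- (2 * u)"] by (intro mult_right_mono) auto
    then show ?thesis
      by (simp add: sinh_field_def left_diff_distrib flip: exp_add)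
  qed
  show ?thesis
    using *[of u] *[of "- u"] by (cases "u \<ge> 0") auto
qed

text \<open>
  The first two moments are read off the moment generating function near 0. The symmetric
  difference quotients \<open>n sinh (Y / n)\<close> tend to \<open>Y\<close>. Their expectations vanish by symmetry, and the
  expectations of their squares are explicit and tend to \<open>v\<close>. Both passages to the limit are justified by
  dominated convergence, with exponentials of multiples of \<open>Y\<close>, integrable by assumption, as
  majorants.
\<close>

lemma (in prob_space) moments_of_gaussian_mgf:
  fixes Y :: "'a \<Rightarrow> real"
  assumes int: "\<And>s. integrable M (\<lambda>\<omega>. exp (s * Y \<omega>))"
    and mgf: "\<And>s. expectation (\<lambda>\<omega>. exp (s * Y \<omega>)) = exp (s\<^sup>2 * v / 2)"
    and [measurable]: "Y \<in> borel_measurable M"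
  shows "integrable M Y" "expectation Y = 0"
    "integrable M (\<lambda>\<omega>. (Y \<omega>)\<^sup>2)" "expectation (\<lambda>\<omega>. (Y \<omega>)\<^sup>2) = v"
proof -
  define q where "q n y = real (Suc n) * sinh (y / real (Suc n))" for n and y :: real
  have q_lim: "(\<lambda>n. q n y) \<longlonglongrightarrow> y" for y unfolding q_def by real_asymp
  have q_bound: "\<bar>q n y\<bar> \<le> exp (2 * \<bar>y\<bar>)" for n y
  proof -
    have "\<bar>q n y\<bar> \<le> real (Suc n) * (\<bar>y / real (Suc n)\<bar> * exp \<bar>y / real (Suc n)\<bar>)"
      unfolding q_def abs_mult using abs_sinh_le[of "y / real (Suc n)"] by (intro mult_mono) auto
    also have "\<dots> = \<bar>y\<bar> * exp (\<bar>y\<bar> / real (Suc n))" by simp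
    also have "\<dots> \<le> exp \<bar>y\<bar> * exp \<bar>y\<bar>"
    proof (intro mult_mono)
      show "\<bar>y\<bar> \<le> exp \<bar>y\<bar>" using exp_ge_add_one_self[of "\<bar>y\<bar>"] by linarith
      show "exp (\<bar>y\<bar> / real (Suc n)) \<le> exp \<bar>y\<bar>" by (simp add: divide_le_eq mult_le_cancel_left1)
    qed auto
    finally show ?thesis by (simp flip: exp_add)
  qed
  have dom: "exp (c * \<bar>y\<bar>) \<le> exp (c * y) + exp (- c * y)" for c y :: real
    by (cases "y \<ge> 0") auto
  have first: "integrable M Y \<and> (\<lambda>n. expectation (\<lambda>\<omega>. q n (Y \<omega>))) \<longlonglongrightarrow> expectation Y"
  proof (intro conjI)
    have 1: "integrable M (\<lambda>\<omega>. exp (2 * Y \<omega>) + exp (- 2 * Y \<omega>))" by (intro Bochner_Integration.integrable_add int)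
    have 2: "AE \<omega> in M. (\<lambda>n. q n (Y \<omega>)) \<longlonglongrightarrow> Y \<omega>" using q_lim by simp
    have 3: "AE \<omega> in M. norm (q n (Y \<omega>)) \<le> exp (2 * Y \<omega>) + exp (- 2 * Y \<omega>)" for n
      using q_bound order_trans[OF _ dom] by (intro AE_I2) (auto simp del: mult_minus_left)
    have 4: "(\<lambda>\<omega>. q n (Y \<omega>)) \<in> borel_measurable M" for n
      unfolding q_def sinh_field_def by measurable
    show "integrable M Y" by (rule integrable_dominated_convergence[OF _ 4 1 2 3]) simp
    show "(\<lambda>n. expectation (\<lambda>\<omega>. q n (Y \<omega>))) \<longlonglongrightarrow> expectation Y"
      by (rule integral_dominated_convergence[OF _ 4 1 2 3]) simp
  qed
  have "expectation (\<lambda>\<omega>. q n (Y \<omega>)) = 0" for n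
  proof -
    have "expectation (\<lambda>\<omega>. q n (Y \<omega>))
        = expectation (\<lambda>\<omega>. real (Suc n) / 2 * (exp (1 / real (Suc n) * Y \<omega>) - exp (- 1 / real (Suc n) * Y \<omega>)))"
      by (intro Bochner_Integration.integral_cong) (auto simp: q_def sinh_field_def)
    also have "\<dots> = 0"
      by (simp only: Bochner_Integration.integral_mult_right_zero
          Bochner_Integration.integral_diff[OF int int] mgf) (simp add: power_divide)
    finally show ?thesis .
  qed
  with first show "integrable M Y" "expectation Y = 0"
    using LIMSEQ_unique[OF _ tendsto_const[of 0 sequentially]] by auto
  have second: "integrable M (\<lambda>\<omega>. (Y \<omega>)\<^sup>2) \<and>
    (\<lambda>n. expectation (\<lambda>\<omega>. (q n (Y \<omega>))\<^sup>2)) \<longlonglongrightarrow> expectation (\<lambda>\<omega>. (Y \<omega>)\<^sup>2)"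
  proof (intro conjI)
    have 1: "integrable M (\<lambda>\<omega>. exp (4 * Y \<omega>) + exp (- 4 * Y \<omega>))" by (intro Bochner_Integration.integrable_add int)
    have 2: "AE \<omega> in M. (\<lambda>n. (q n (Y \<omega>))\<^sup>2) \<longlonglongrightarrow> (Y \<omega>)\<^sup>2" by (intro AE_I2 tendsto_intros q_lim)
    have sq: "(q n y)\<^sup>2 \<le> exp (4 * \<bar>y\<bar>)" for n y
    proof -
      have "\<bar>q n y\<bar>\<^sup>2 \<le> (exp (2 * \<bar>y\<bar>))\<^sup>2" by (intro power_mono q_bound) auto
      then show ?thesis by (simp flip: exp_double)
    qed
    have 3: "AE \<omega> in M. norm ((q n (Y \<omega>))\<^sup>2) \<le> exp (4 * Y \<omega>) + exp (- 4 * Y \<omega>)" for n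
      using order_trans[OF sq dom] by (intro AE_I2) (auto simp del: mult_minus_left)
    have 4: "(\<lambda>\<omega>. (q n (Y \<omega>))\<^sup>2) \<in> borel_measurable M" for n
      unfolding q_def sinh_field_def by measurable
    show "integrable M (\<lambda>\<omega>. (Y \<omega>)\<^sup>2)" by (rule integrable_dominated_convergence[OF _ 4 1 2 3]) simp
    show "(\<lambda>n. expectation (\<lambda>\<omega>. (q n (Y \<omega>))\<^sup>2)) \<longlonglongrightarrow> expectation (\<lambda>\<omega>. (Y \<omega>)\<^sup>2)"
      by (rule integral_dominated_convergence[OF _ 4 1 2 3]) simp
  qed
  have "expectation (\<lambda>\<omega>. (q n (Y \<omega>))\<^sup>2) = (real (Suc n))\<^sup>2 / 2 * (exp (2 * v / (real (Suc n))\<^sup>2) - 1)" for n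
  proof -
    have "expectation (\<lambda>\<omega>. (q n (Y \<omega>))\<^sup>2) = expectation (\<lambda>\<omega>. (real (Suc n))\<^sup>2 / 4 *
        (exp (2 / real (Suc n) * Y \<omega>) + exp (- 2 / real (Suc n) * Y \<omega>) - 2))"
    proof (intro Bochner_Integration.integral_cong refl)
      fix \<omega>
      have "(exp a - exp (- a))\<^sup>2 = exp (2 * a) + exp (- 2 * a) - 2" for a :: real
        by (simp add: power2_diff flip: exp_double exp_add)
      from this[of "Y \<omega> / real (Suc n)"]
      show "(q n (Y \<omega>))\<^sup>2 = (real (Suc n))\<^sup>2 / 4 *
        (exp (2 / real (Suc n) * Y \<omega>) + exp (- 2 / real (Suc n) * Y \<omega>) - 2)"
        by (simp add: q_def sinh_field_def power_mult_distrib power_divide)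
    qed
    also have "\<dots> = (real (Suc n))\<^sup>2 / 4 * (exp ((2 / real (Suc n))\<^sup>2 * v / 2) + exp ((- 2 / real (Suc n))\<^sup>2 * v / 2) - 2)"
      by (simp only: Bochner_Integration.integral_mult_right_zero
          Bochner_Integration.integral_diff[OF Bochner_Integration.integrable_add[OF int int] integrable_const]
          Bochner_Integration.integral_add[OF int int] mgf) (simp add: prob_space)
    also have "\<dots> = (real (Suc n))\<^sup>2 / 2 * (exp (2 * v / (real (Suc n))\<^sup>2) - 1)"
      by (simp add: power_divide)
    finally show ?thesis .
  qed
  moreover have "(\<lambda>n. (real (Suc n))\<^sup>2 / 2 * (exp (2 * v / (real (Suc n))\<^sup>2) - 1)) \<longlonglongrightarrow> v"
    by real_asymp
  ultimately have "(\<lambda>n. expectation (\<lambda>\<omega>. (q n (Y \<omega>))\<^sup>2)) \<longlonglongrightarrow> v" by (simp only:)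
  then show "integrable M (\<lambda>\<omega>. (Y \<omega>)\<^sup>2)" "expectation (\<lambda>\<omega>. (Y \<omega>)\<^sup>2) = v"
    using second by (auto intro: LIMSEQ_unique)
qed

text \<open>
  Completing the square: multiplying a centred Gaussian density by an exponential \<open>exp (a \<bullet> x)\<close>
  translates it, up to a constant factor, to the mean \<open>G a\<close>.
\<close>

lemma gaussian_density_tilt:
  fixes G :: "real^'n^'n"
  assumes "spd_matrix G"
  shows "gaussian_density 0 G x * exp (a \<bullet> x)
    = exp (a \<bullet> (G *v a) / 2) * gaussian_density 0 G (x - G *v a)"
proof -
  let ?H = "matrix_inv G"
  note H = spd_matrix_inverse[OF assms]
  have HG: "?H *v (G *v a) = a" by (simp add: matrix_vector_mul_assoc H)
  have "(G *v a) \<bullet> (?H *v x) = a \<bullet> x"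
    using inner_matrix_vector_transpose[of "G *v a" ?H x] by (simp only: H HG)
  then have "(x - G *v a) \<bullet> (?H *v (x - G *v a)) = x \<bullet> (?H *v x) - 2 * (a \<bullet> x) + a \<bullet> (G *v a)"
    by (simp add: matrix_vector_mult_diff_distrib inner_diff_left inner_diff_right HG inner_commute)
  then have "- (x \<bullet> (?H *v x)) / 2 + a \<bullet> x
      = a \<bullet> (G *v a) / 2 + - ((x - G *v a) \<bullet> (?H *v (x - G *v a))) / 2"
    by argo
  from arg_cong[OF this, of exp] show ?thesis
    by (simp only: gaussian_density_def exp_add diff_zero) simp
qed

text \<open>
  By the tilting identity and the translation invariance of Lebesgue measure, \<open>exp (a \<bullet> G a / 2)\<close> is
  the expectation of \<open>exp (a \<bullet> X)\<close>. The normalization of the density enters through the total mass 1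
  of the underlying probability space. Applied to all multiples of \<open>a\<close>, this is the Gaussian moment
  generating function of \<open>a \<bullet> X\<close> with variance \<open>a \<bullet> G a\<close>.
\<close>

lemma (in prob_space) gaussian_vector_moments:
  fixes X :: "'a \<Rightarrow> real^'n"
  assumes G: "spd_matrix G" and X: "gaussian_vector M X 0 G"
  shows "integrable M (\<lambda>\<omega>. a \<bullet> X \<omega>)" "expectation (\<lambda>\<omega>. a \<bullet> X \<omega>) = 0"
    "integrable M (\<lambda>\<omega>. (a \<bullet> X \<omega>)\<^sup>2)" "expectation (\<lambda>\<omega>. (a \<bullet> X \<omega>)\<^sup>2) = a \<bullet> (G *v a)"
proof -
  define f where "f = gaussian_density 0 G"
  have D: "distributed M lborel X (\<lambda>x. ennreal (f x))"
    using X by (simp add: gaussian_vector_def f_def)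
  have Xm[measurable]: "X \<in> borel_measurable M" using D by (simp add: distributed_def)
  \<comment> \<open>The real density determines the distribution through its nonnegative part only. If the
    normalizing constant were negative, that part would vanish and the total mass would be 0.\<close>
  have f_nonneg: "0 \<le> f x" for x
  proof (rule ccontr)
    assume "\<not> 0 \<le> f x"
    then have "sqrt ((2 * pi) ^ CARD('n) * det G) < 0"
      by (simp add: f_def gaussian_density_def zero_le_divide_iff not_le)
    then have "f z \<le> 0" for z by (simp add: f_def gaussian_density_def divide_le_0_iff)
    then have "density lborel (\<lambda>x. ennreal (f x)) = density lborel (\<lambda>_. 0)"
      by (simp add: ennreal_neg)
    moreover have "density lborel (\<lambda>x. ennreal (f x)) = distr M lborel X"
      using D by (simp add: distributed_def)
    moreover have "emeasure (distr M lborel X) (space lborel) = 1"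
      by (subst emeasure_distr) (auto simp: emeasure_space_1)
    moreover have "emeasure (density (lborel :: (real^'n) measure) (\<lambda>_. 0)) (space lborel) = 0"
      by (simp add: emeasure_density)
    ultimately show False by simp
  qed
  have f_int: "integrable lborel f" "(\<integral>x. f x \<partial>lborel) = 1"
    using distributed_integrable[OF D, of "\<lambda>_. 1 :: real"] distributed_integral[OF D, of "\<lambda>_. 1 :: real"] f_nonneg
    by (auto simp: prob_space)
  have shift: "integrable lborel (\<lambda>x. f (x - c)) \<and> (\<integral>x. f (x - c) \<partial>lborel) = 1" for c
  proof -
    have [measurable]: "f \<in> borel_measurable borel" using f_int by auto
    have eq: "distr lborel borel ((+) (- c)) = lborel" by (rule lborel_distr_plus)
    have "integrable (distr lborel borel ((+) (- c))) f" "integral\<^sup>L (distr lborel borel ((+) (- c))) f = 1"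
      unfolding eq by (fact f_int)+
    then show ?thesis by (simp add: integrable_distr_eq integral_distr)
  qed
  have mgf: "integrable M (\<lambda>\<omega>. exp (b \<bullet> X \<omega>)) \<and> expectation (\<lambda>\<omega>. exp (b \<bullet> X \<omega>)) = exp (b \<bullet> (G *v b) / 2)" for b
  proof -
    have tilt: "f x * exp (b \<bullet> x) = exp (b \<bullet> (G *v b) / 2) * f (x - G *v b)" for x
      using gaussian_density_tilt[OF G, of x b] by (simp only: f_def)
    have "integrable lborel (\<lambda>x. f x * exp (b \<bullet> x))"
      "(\<integral>x. f x * exp (b \<bullet> x) \<partial>lborel) = exp (b \<bullet> (G *v b) / 2)"
      unfolding tilt using shift[of "G *v b"] by simp_all
    moreover have "(\<lambda>x. exp (b \<bullet> x)) \<in> borel_measurable lborel" by measurable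
    ultimately show ?thesis
      using distributed_integrable[OF D, of "\<lambda>x. exp (b \<bullet> x)"]
        distributed_integral[OF D, of "\<lambda>x. exp (b \<bullet> x)"] f_nonneg by metis
  qed
  have 1: "integrable M (\<lambda>\<omega>. exp (s * (a \<bullet> X \<omega>)))" for s
    using mgf[of "s *\<^sub>R a"] by simp
  have 2: "expectation (\<lambda>\<omega>. exp (s * (a \<bullet> X \<omega>))) = exp (s\<^sup>2 * (a \<bullet> (G *v a)) / 2)" for s
    using mgf[of "s *\<^sub>R a"] by (simp add: matrix_vector_mult_scaleR power2_eq_square mult.assoc)
  have 3: "(\<lambda>\<omega>. a \<bullet> X \<omega>) \<in> borel_measurable M" by measurable
  show "integrable M (\<lambda>\<omega>. a \<bullet> X \<omega>)" "expectation (\<lambda>\<omega>. a \<bullet> X \<omega>) = 0"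
    "integrable M (\<lambda>\<omega>. (a \<bullet> X \<omega>)\<^sup>2)" "expectation (\<lambda>\<omega>. (a \<bullet> X \<omega>)\<^sup>2) = a \<bullet> (G *v a)"
    using moments_of_gaussian_mgf[OF 1 2 3] by auto
qed

text \<open>
  The events generated by a linear functional of a vector are among those generated by the vector. The
  passage to real-valued functionals brings the two variables into one type, as required by
  \<open>indep_var\<close>.
\<close>

lemma (in prob_space) indep_vectors_indep_var_inner:
  assumes "indep_vectors M X Y"
  shows "indep_var borel (\<lambda>\<omega>. a \<bullet> X \<omega>) borel (\<lambda>\<omega>. b \<bullet> Y \<omega>)"
proof -
  let ?GX = "{X -` B \<inter> space M | B. B \<in> sets borel}" and ?GY = "{Y -` B \<inter> space M | B. B \<in> sets borel}"
  have m[measurable]: "X \<in> borel_measurable M" "Y \<in> borel_measurable M" and ind: "indep_set ?GX ?GY"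
    using assms by (auto simp: indep_vectors_def)
  have sub: "{(\<lambda>\<omega>. c \<bullet> Z \<omega>) -` B \<inter> space M | B. B \<in> sets borel} \<subseteq> {Z -` B \<inter> space M | B. B \<in> sets borel}"
    for c and Z :: "'a \<Rightarrow> real^'m"
  proof safe
    fix B :: "real set" assume "B \<in> sets borel"
    then have "(\<lambda>x. c \<bullet> x) -` B \<in> sets borel"
      using measurable_sets_borel[of "\<lambda>x. c \<bullet> x" borel B] by simp
    moreover have "(\<lambda>\<omega>. c \<bullet> Z \<omega>) -` B \<inter> space M = Z -` ((\<lambda>x. c \<bullet> x) -` B) \<inter> space M" by auto
    ultimately show "\<exists>C. (\<lambda>\<omega>. c \<bullet> Z \<omega>) -` B \<inter> space M = Z -` C \<inter> space M \<and> C \<in> sets borel" by blast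
  qed
  have ind': "indep_set {(\<lambda>\<omega>. a \<bullet> X \<omega>) -` B \<inter> space M | B. B \<in> sets borel}
      {(\<lambda>\<omega>. b \<bullet> Y \<omega>) -` B \<inter> space M | B. B \<in> sets borel}"
    using ind unfolding indep_set_def
  proof (rule indep_sets_mono_sets)
    show "(case i of True \<Rightarrow> {(\<lambda>\<omega>. a \<bullet> X \<omega>) -` B \<inter> space M | B. B \<in> sets borel}
        | False \<Rightarrow> {(\<lambda>\<omega>. b \<bullet> Y \<omega>) -` B \<inter> space M | B. B \<in> sets borel})
      \<subseteq> (case i of True \<Rightarrow> ?GX | False \<Rightarrow> ?GY)" for i
      by (cases i) (simp_all only: bool.case sub)
  qed
  have stable: "Int_stable {Z -` B \<inter> space M | B. B \<in> sets borel}" for Z :: "'a \<Rightarrow> real"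
  proof (rule Int_stableI)
    fix P Q assume "P \<in> {Z -` B \<inter> space M | B. B \<in> sets borel}" "Q \<in> {Z -` B \<inter> space M | B. B \<in> sets borel}"
    then obtain B C where "B \<in> sets borel" "C \<in> sets borel" "P = Z -` B \<inter> space M" "Q = Z -` C \<inter> space M" by auto
    then have "P \<inter> Q = Z -` (B \<inter> C) \<inter> space M" "B \<inter> C \<in> sets borel" by auto
    then show "P \<inter> Q \<in> {Z -` B \<inter> space M | B. B \<in> sets borel}" by blast
  qed
  show ?thesis
    unfolding indep_var_eq using indep_set_sigma_sets[OF ind' stable stable] by simp
qed

section \<open>Bayes risk of linear estimators\<close>

lemma trace_congruence:
  fixes C :: "real^'n^'m" and S :: "real^'n^'n"
  shows "trace (C ** S ** transpose C) = (\<Sum>i\<in>UNIV. row i C \<bullet> (S *v row i C))"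
proof -
  have "(C ** S ** transpose C) $ i $ i = row i C \<bullet> (S *v row i C)" for i
    by (simp add: matrix_matrix_mult_def matrix_vector_mult_def inner_vec_def row_def transpose_def
        sum_distrib_left sum_distrib_right) (subst sum.swap, simp add: mult_ac)
  then show ?thesis by (simp add: trace_def)
qed

text \<open>
  The error of a linear estimator is \<open>(L A - I) m + L \<eta>\<close>. Each of its coordinates is a sum of two
  independent centred variables, so the mixed terms disappear from the mean square and only the second
  moments of \<open>m\<close> and \<open>\<eta>\<close> remain.
\<close>

lemma (in prob_space) bayes_risk_linear_estimator:
  fixes A :: "real^'n^'k" and L :: "real^'k^'n" and m :: "'a \<Rightarrow> real^'n" and \<eta> y :: "'a \<Rightarrow> real^'k"
  assumes Gp: "spd_matrix Gprior" and Gn: "spd_matrix Gnoise"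
    and m: "gaussian_vector M m 0 Gprior" and \<eta>: "gaussian_vector M \<eta> 0 Gnoise"
    and ind: "indep_vectors M m \<eta>"
    and y: "\<And>\<omega>. \<omega> \<in> space M \<Longrightarrow> y \<omega> = A *v m \<omega> + \<eta> \<omega>"
  shows "bayes_risk M m y (\<lambda>z. L *v z)
    = trace ((L ** A - mat 1) ** Gprior ** transpose (L ** A - mat 1)) + trace (L ** Gnoise ** transpose L)"
proof -
  let ?C = "L ** A - mat 1"
  have m': "integrable M (\<lambda>\<omega>. a \<bullet> m \<omega>)" "expectation (\<lambda>\<omega>. a \<bullet> m \<omega>) = 0"
    "integrable M (\<lambda>\<omega>. (a \<bullet> m \<omega>)\<^sup>2)" "expectation (\<lambda>\<omega>. (a \<bullet> m \<omega>)\<^sup>2) = a \<bullet> (Gprior *v a)" for a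
    by (fact gaussian_vector_moments[OF Gp m])+
  have \<eta>': "integrable M (\<lambda>\<omega>. b \<bullet> \<eta> \<omega>)" "expectation (\<lambda>\<omega>. b \<bullet> \<eta> \<omega>) = 0"
    "integrable M (\<lambda>\<omega>. (b \<bullet> \<eta> \<omega>)\<^sup>2)" "expectation (\<lambda>\<omega>. (b \<bullet> \<eta> \<omega>)\<^sup>2) = b \<bullet> (Gnoise *v b)" for b
    by (fact gaussian_vector_moments[OF Gn \<eta>])+
  have cross: "integrable M (\<lambda>\<omega>. (a \<bullet> m \<omega>) * (b \<bullet> \<eta> \<omega>))" "expectation (\<lambda>\<omega>. (a \<bullet> m \<omega>) * (b \<bullet> \<eta> \<omega>)) = 0" for a b
    using indep_var_integrable[OF indep_vectors_indep_var_inner[OF ind] m'(1) \<eta>'(1), of a b]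
      indep_var_lebesgue_integral[OF indep_vectors_indep_var_inner[OF ind] m'(1) \<eta>'(1), of a b] m'(2) \<eta>'(2)
    by auto
  have sq: "(a \<bullet> m \<omega> + b \<bullet> \<eta> \<omega>)\<^sup>2 = (a \<bullet> m \<omega>)\<^sup>2 + (b \<bullet> \<eta> \<omega>)\<^sup>2 + 2 * ((a \<bullet> m \<omega>) * (b \<bullet> \<eta> \<omega>))" for a b \<omega>
    by (simp add: power2_sum)
  have E: "integrable M (\<lambda>\<omega>. (a \<bullet> m \<omega> + b \<bullet> \<eta> \<omega>)\<^sup>2)"
    "expectation (\<lambda>\<omega>. (a \<bullet> m \<omega> + b \<bullet> \<eta> \<omega>)\<^sup>2) = a \<bullet> (Gprior *v a) + b \<bullet> (Gnoise *v b)" for a b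
    unfolding sq using m'(3,4)[of a] \<eta>'(3,4)[of b] cross[of a b] by simp_all
  have comp: "(P *v x) $ i = row i P \<bullet> x" for P :: "real^'q^'p" and x i
    by (simp add: matrix_vector_mult_def row_def inner_vec_def)
  have norm_sq: "(norm x)\<^sup>2 = (\<Sum>i\<in>UNIV. (x $ i)\<^sup>2)" for x :: "real^'p"
    unfolding power2_norm_eq_inner inner_vec_def by (simp add: power2_eq_square)
  have "bayes_risk M m y (\<lambda>z. L *v z) = expectation (\<lambda>\<omega>. \<Sum>i\<in>UNIV. (row i ?C \<bullet> m \<omega> + row i L \<bullet> \<eta> \<omega>)\<^sup>2)"
    unfolding bayes_risk_def
  proof (intro Bochner_Integration.integral_cong refl)
    fix \<omega> assume "\<omega> \<in> space M"
    then have "L *v y \<omega> - m \<omega> = ?C *v m \<omega> + L *v \<eta> \<omega>"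
      by (simp add: y matrix_vector_right_distrib matrix_vector_mult_diff_rdistrib matrix_vector_mul_assoc)
    then have "(norm (L *v y \<omega> - m \<omega>))\<^sup>2 = (\<Sum>i\<in>UNIV. ((?C *v m \<omega> + L *v \<eta> \<omega>) $ i)\<^sup>2)"
      by (simp only: norm_sq)
    then show "(norm (L *v y \<omega> - m \<omega>))\<^sup>2 = (\<Sum>i\<in>UNIV. (row i ?C \<bullet> m \<omega> + row i L \<bullet> \<eta> \<omega>)\<^sup>2)"
      by (simp only: vector_add_component comp)
  qed
  also have "\<dots> = (\<Sum>i\<in>UNIV. row i ?C \<bullet> (Gprior *v row i ?C) + row i L \<bullet> (Gnoise *v row i L))"
    by (simp add: Bochner_Integration.integral_sum E)
  also have "\<dots> = trace (?C ** Gprior ** transpose ?C) + trace (L ** Gnoise ** transpose L)"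
    by (simp add: trace_congruence sum.distrib)
  finally show ?thesis .
qed

section \<open>Comparison of the least squares and MAP estimators\<close>

lemma trace_congruence_nonneg:
  fixes C :: "real^'n^'m" and S :: "real^'n^'n"
  assumes "spd_matrix S"
  shows "0 \<le> trace (C ** S ** transpose C)"
proof -
  have "0 \<le> x \<bullet> (S *v x)" for x
    using assms by (cases "x = 0") (auto simp: spd_matrix_def less_imp_le)
  then show ?thesis unfolding trace_congruence by (intro sum_nonneg) auto
qed

text \<open>
  The value of the Bayes risk from \<open>bayes_risk_linear_estimator\<close>, as a function of the matrix alone, so
  that its minimization is a question about matrices.
\<close>

definition linear_risk ::
    "real^'n^'k \<Rightarrow> real^'n^'n \<Rightarrow> real^'k^'k \<Rightarrow> real^'k^'n \<Rightarrow> real" where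
  "linear_risk A Gprior Gnoise L =
     trace ((L ** A - mat 1) ** Gprior ** transpose (L ** A - mat 1)) + trace (L ** Gnoise ** transpose L)"

text \<open>
  The risk is a quadratic function of the estimator matrix. For positive definite covariances the part quadratic
  in \<open>E\<close> is nonnegative, so \<open>L\<close> is a minimizer as soon as the factor \<open>(L A - I) Gprior A\<^sup>T + L Gnoise\<close> of the linear part
  vanishes.
\<close>

lemma linear_risk_add:
  fixes A :: "real^'n^'k" and L E :: "real^'k^'n"
  assumes "transpose Gprior = Gprior" "transpose Gnoise = Gnoise"
  shows "linear_risk A Gprior Gnoise (L + E) = linear_risk A Gprior Gnoise L
    + (trace ((E ** A) ** Gprior ** transpose (E ** A)) + trace (E ** Gnoise ** transpose E))
    + 2 * trace (((L ** A - mat 1) ** Gprior ** transpose A + L ** Gnoise) ** transpose E)"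
proof -
  have cross: "trace ((C + D) ** S ** transpose (C + D))
      = trace (C ** S ** transpose C) + trace (D ** S ** transpose D) + 2 * trace (C ** S ** transpose D)"
    if "transpose S = S" for C D :: "real^'m^'n" and S
  proof -
    have tr: "trace (transpose X) = trace X" for X :: "real^'n^'n"
      by (simp add: trace_def transpose_def)
    have "transpose (C ** S ** transpose D) = D ** S ** transpose C"
      by (simp add: matrix_transpose_mul that matrix_mul_assoc)
    then have "trace (D ** S ** transpose C) = trace (C ** S ** transpose D)"
      by (metis tr)
    then show ?thesis
      by (simp add: transpose_add matrix_add_rdistrib matrix_add_ldistrib trace_add)
  qed
  have "(L + E) ** A - mat 1 = (L ** A - mat 1) + E ** A"
    by (simp add: matrix_add_rdistrib)
  moreover have "trace (((L ** A - mat 1) ** Gprior ** transpose A + L ** Gnoise) ** transpose E)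
      = trace ((L ** A - mat 1) ** Gprior ** transpose (E ** A)) + trace (L ** Gnoise ** transpose E)"
    by (simp add: matrix_add_rdistrib trace_add matrix_transpose_mul matrix_mul_assoc)
  ultimately show ?thesis
    unfolding linear_risk_def by (simp only: cross assms) simp
qed

context
  fixes A :: "real^'n^'k" and Gprior :: "real^'n^'n" and Gnoise :: "real^'k^'k"
  assumes Gp: "spd_matrix Gprior" and Gn: "spd_matrix Gnoise"
begin

lemma precision_spd: "spd_matrix (matrix_inv Gprior + transpose A ** matrix_inv Gnoise ** A)"
  unfolding spd_matrix_def
proof (intro conjI allI impI)
  note p = spd_matrix_inverse[OF Gp] and n = spd_matrix_inverse[OF Gn]
  show "transpose (matrix_inv Gprior + transpose A ** matrix_inv Gnoise ** A)
      = matrix_inv Gprior + transpose A ** matrix_inv Gnoise ** A"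
    by (simp add: transpose_add matrix_transpose_mul p n matrix_mul_assoc)
  fix x :: "real^'n" assume "x \<noteq> 0"
  then have "0 < x \<bullet> (matrix_inv Gprior *v x)" using p(4) by (simp add: spd_matrix_def)
  moreover have "0 \<le> (A *v x) \<bullet> (matrix_inv Gnoise *v (A *v x))"
    using n(4) by (cases "A *v x = 0") (auto simp: spd_matrix_def less_imp_le)
  moreover have "x \<bullet> (transpose A *v (matrix_inv Gnoise *v (A *v x)))
      = (A *v x) \<bullet> (matrix_inv Gnoise *v (A *v x))"
    using inner_matrix_vector_transpose[of x "transpose A" "matrix_inv Gnoise *v (A *v x)"]
    by (simp only: transpose_transpose)
  ultimately show "0 < x \<bullet> ((matrix_inv Gprior + transpose A ** matrix_inv Gnoise ** A) *v x)"
    by (simp only: matrix_vector_mult_add_rdistrib inner_add_right matrix_vector_mul_assoc[symmetric])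
qed

lemma posterior_cov_spd: "spd_matrix (posterior_cov A Gprior Gnoise)"
  unfolding posterior_cov_def by (rule spd_matrix_inverse(4)[OF precision_spd])

text \<open>
  Multiplying the posterior precision by its inverse gives \<open>I\<close>, and the contribution of the data to that
  product is exactly \<open>L A\<close> for the MAP matrix \<open>L\<close>.
\<close>

lemma MAP_residual:
  defines "\<Gamma> \<equiv> posterior_cov A Gprior Gnoise"
  shows "\<Gamma> ** transpose A ** matrix_inv Gnoise ** A - mat 1 = - (\<Gamma> ** matrix_inv Gprior)"
proof -
  have "\<Gamma> ** (matrix_inv Gprior + transpose A ** matrix_inv Gnoise ** A) = mat 1"
    unfolding \<Gamma>_def posterior_cov_def by (rule spd_matrix_inverse(2)[OF precision_spd])
  then have "\<Gamma> ** matrix_inv Gprior + \<Gamma> ** transpose A ** matrix_inv Gnoise ** A = mat 1"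
    by (simp add: matrix_add_ldistrib matrix_mul_assoc)
  then show ?thesis by (simp add: algebra_simps eq_neg_iff_add_eq_0)
qed

text \<open>
  Stationarity of the risk at the MAP matrix: both terms equal the posterior covariance times \<open>A\<^sup>T\<close>, with
  opposite signs.
\<close>

lemma MAP_normal_equation:
  defines "L \<equiv> posterior_cov A Gprior Gnoise ** transpose A ** matrix_inv Gnoise"
  shows "(L ** A - mat 1) ** Gprior ** transpose A + L ** Gnoise = 0"
proof -
  have "(L ** A - mat 1) ** Gprior = - posterior_cov A Gprior Gnoise"
  proof -
    have "(L ** A - mat 1) ** Gprior = (0 - posterior_cov A Gprior Gnoise ** matrix_inv Gprior) ** Gprior"
      unfolding L_def MAP_residual by simp
    also have "\<dots> = 0 - posterior_cov A Gprior Gnoise ** (matrix_inv Gprior ** Gprior)"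
      by (simp only: matrix_diff_rdistrib matrix_mul_assoc) (simp add: matrix_matrix_mult_def vec_eq_iff)
    finally show ?thesis by (simp add: spd_matrix_inverse[OF Gp])
  qed
  moreover have "L ** Gnoise = posterior_cov A Gprior Gnoise ** transpose A"
    by (simp add: L_def spd_matrix_inverse[OF Gn] flip: matrix_mul_assoc)
  moreover have "(- posterior_cov A Gprior Gnoise) ** transpose A = - (posterior_cov A Gprior Gnoise ** transpose A)"
    by (simp add: matrix_matrix_mult_def vec_eq_iff sum_negf)
  ultimately show ?thesis by simp
qed

lemma MAP_minimizes_linear_risk:
  "linear_risk A Gprior Gnoise (posterior_cov A Gprior Gnoise ** transpose A ** matrix_inv Gnoise)
    \<le> linear_risk A Gprior Gnoise L"
proof -
  let ?L = "posterior_cov A Gprior Gnoise ** transpose A ** matrix_inv Gnoise"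
  have "linear_risk A Gprior Gnoise L = linear_risk A Gprior Gnoise (?L + (L - ?L))" by simp
  also have "\<dots> \<ge> linear_risk A Gprior Gnoise ?L"
    using Gp Gn trace_congruence_nonneg[OF Gp, of "(L - ?L) ** A"] trace_congruence_nonneg[OF Gn, of "L - ?L"]
    by (subst linear_risk_add) (auto simp: spd_matrix_def MAP_normal_equation mat_0[symmetric] trace_0
      simp del: mat_0)
  finally show ?thesis .
qed

text \<open>
  By the normal equation the risk at a stationary matrix \<open>L\<close> collapses to the trace of
  \<open>- (L A - I) Gprior\<close>.
\<close>

lemma linear_risk_MAP:
  "linear_risk A Gprior Gnoise (posterior_cov A Gprior Gnoise ** transpose A ** matrix_inv Gnoise)
    = trace (posterior_cov A Gprior Gnoise)"
proof -
  let ?\<Gamma> = "posterior_cov A Gprior Gnoise"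
  let ?L = "?\<Gamma> ** transpose A ** matrix_inv Gnoise"
  let ?C = "?L ** A - mat 1"
  note eq = MAP_normal_equation
  have "?C ** Gprior ** transpose ?C + ?L ** Gnoise ** transpose ?L
      = (?C ** Gprior ** transpose A + ?L ** Gnoise) ** transpose ?L - ?C ** Gprior"
    by (simp add: transpose_diff matrix_transpose_mul matrix_add_rdistrib matrix_diff_ldistrib matrix_mul_assoc)
  also have "\<dots> = - (?C ** Gprior)"
    unfolding eq by (simp add: matrix_matrix_mult_def vec_eq_iff)
  also have "\<dots> = ?\<Gamma>"
  proof -
    have "?C ** Gprior = - (?\<Gamma> ** matrix_inv Gprior ** Gprior)"
      unfolding MAP_residual by (simp add: matrix_matrix_mult_def vec_eq_iff sum_negf)
    then show ?thesis by (simp add: spd_matrix_inverse[OF Gp] flip: matrix_mul_assoc)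
  qed
  finally show ?thesis by (simp add: linear_risk_def flip: trace_add)
qed

text \<open>
  For least squares, \<open>A\<^sup>+ A - I = - N\<close> with the orthogonal projector \<open>N\<close> onto the kernel of \<open>A\<close>. The
  prior therefore contributes \<open>tr (N Gprior)\<close>. Replacing the trace of the posterior covariance by the
  smaller \<open>tr (N \<Gamma>)\<close> leaves \<open>tr (N (Gprior - \<Gamma>))\<close>, to which Ky Fan's inequality applies.
\<close>

lemma linear_risk_LS_le:
  "linear_risk A Gprior Gnoise (pseudoinverse A) - trace (posterior_cov A Gprior Gnoise)
    \<le> trace (pseudoinverse A ** Gnoise ** transpose (pseudoinverse A))
      + (\<Sum>i = 1..nullity A. nth_eigenvalue (Gprior - posterior_cov A Gprior Gnoise) i)"
proof -
  let ?\<Gamma> = "posterior_cov A Gprior Gnoise"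
  define N where "N = mat 1 - pseudoinverse A ** A"
  have N: "transpose N = N" "N ** N = N" "trace N = real (nullity A)"
    unfolding N_def by (fact pseudoinverse_kernel_projector)+
  have proj: "trace (P ** S ** transpose P) = trace (P ** S)" 
    if "transpose P = P" "P ** P = P" for P S :: "real^'n^'n"
    using trace_mul_sym[of "P ** S" P] by (simp add: that matrix_mul_assoc)
  have "(pseudoinverse A ** A - mat 1) ** Gprior ** transpose (pseudoinverse A ** A - mat 1)
      = N ** Gprior ** transpose N"
    by (simp add: N_def transpose_diff matrix_diff_rdistrib matrix_diff_ldistrib)
  then have "linear_risk A Gprior Gnoise (pseudoinverse A)
      = trace (N ** Gprior) + trace (pseudoinverse A ** Gnoise ** transpose (pseudoinverse A))"
    by (simp only: linear_risk_def proj[OF N(1,2)])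
  moreover have "trace (N ** ?\<Gamma>) \<le> trace ?\<Gamma>"
  proof -
    have "0 \<le> trace ((mat 1 - N) ** ?\<Gamma> ** transpose (mat 1 - N))"
      by (rule trace_congruence_nonneg[OF posterior_cov_spd])
    also have "\<dots> = trace ((mat 1 - N) ** ?\<Gamma>)"
      by (rule proj) (simp_all add: transpose_diff transpose_mat N matrix_diff_rdistrib matrix_diff_ldistrib)
    also have "\<dots> = trace ?\<Gamma> - trace (N ** ?\<Gamma>)"
      by (simp add: matrix_diff_rdistrib trace_sub)
    finally show ?thesis by simp
  qed
  moreover have "trace (N ** (Gprior - ?\<Gamma>)) \<le> (\<Sum>i = 1..nullity A. nth_eigenvalue (Gprior - ?\<Gamma>) i)"
  proof (rule ky_fan_projection[OF _ N])
    show "transpose (Gprior - ?\<Gamma>) = Gprior - ?\<Gamma>"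
      using Gp posterior_cov_spd by (simp add: transpose_diff spd_matrix_def)
  qed
  ultimately show ?thesis by (simp add: matrix_diff_ldistrib trace_sub)
qed

end

theorem theorem3p4:
  fixes A :: "real^'n^'k"
    and Gprior :: "real^'n^'n" and Gnoise :: "real^'k^'k"
    and M :: "'w measure"
    and m :: "'w \<Rightarrow> real^'n" and \<eta> y :: "'w \<Rightarrow> real^'k"
  assumes "spd_matrix Gprior" and "spd_matrix Gnoise"
    and "prob_space M"
    and "gaussian_vector M m 0 Gprior"
    and "gaussian_vector M \<eta> 0 Gnoise"
    and "indep_vectors M m \<eta>"
    and "\<And>\<omega>. \<omega> \<in> space M \<Longrightarrow> y \<omega> = A *v m \<omega> + \<eta> \<omega>"
  shows "0 \<le> bayes_risk M m y (LS_estimator A) - bayes_risk M m y (MAP_estimator A Gprior Gnoise)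
    \<and> bayes_risk M m y (LS_estimator A) - bayes_risk M m y (MAP_estimator A Gprior Gnoise)
      \<le> trace (pseudoinverse A ** Gnoise ** transpose (pseudoinverse A))
        + (\<Sum>i = 1..nullity A. nth_eigenvalue (Gprior - posterior_cov A Gprior Gnoise) i)"
proof -
  interpret prob_space M by fact
  let ?L = "posterior_cov A Gprior Gnoise ** transpose A ** matrix_inv Gnoise"
  have risk: "bayes_risk M m y (\<lambda>z. L *v z) = linear_risk A Gprior Gnoise L" for L
    unfolding linear_risk_def by (rule bayes_risk_linear_estimator[OF assms(1,2,4-7)])
  have LS: "bayes_risk M m y (LS_estimator A) = linear_risk A Gprior Gnoise (pseudoinverse A)"
    unfolding LS_estimator_def[abs_def] by (rule risk)
  have MAP: "bayes_risk M m y (MAP_estimator A Gprior Gnoise) = linear_risk A Gprior Gnoise ?L"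
    unfolding MAP_estimator_def[abs_def] by (rule risk)
  show ?thesis
    using MAP_minimizes_linear_risk[OF assms(1,2), of A "pseudoinverse A"]
      linear_risk_LS_le[OF assms(1,2), of A]
    unfolding LS MAP linear_risk_MAP[OF assms(1,2)] by simp
qed

end
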